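(* Let $\pi=(\pi_1,\pi_2,\dots,\pi_n)$ be an arbitrary permutation of $(1,2,\dots,n)$ and define $M_\pi=\prod_{i\in\pi}G_i=G_{\pi_1}G_{\pi_2}\cdots G_{\pi_n}$, where for $1\le k\le n$ $$G_k=\begin{bmatrix}I_{k-1}&0&0&0\\0&\alpha_k&\beta_k&0\\0&\gamma_k&\delta_k&0\\0&0&0&I_{n-k}\end{bmatrix}\in\mathbb C^{(n+1)\times(n+1)}.$$ Let $A$ and $D$ both be arbitrary diagonal matrices of size $n+1$ and set $P=[\,I_n\;\;0\,]\in\mathbb C^{n\times(n+1)}$. Then $\det\bigl(P(AM_\pi+D)P^*\bigr)$ does not depend on $\pi$.
   Context: $I_m$ denotes the $m\times m$ identity matrix ($I_0$ is the empty matrix). All matrices are complex, and $\alpha_k,\beta_k,\gamma_k,\delta_k$ are arbitrary complex numbers. $P^*$ is the conjugate transpose of $P$, so for an $(n+1)\times(n+1)$ matrix $X$, $PXP^*$ is the leading principal $n\times n$ submatrix (truncation) of $X$. The product $\prod_{i\in\pi}G_i$ is taken from left to right in the order given by $\pi$. *)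

theory Defs
  imports
    "Jordan_Normal_Form.Schur_Decomposition"
    "HOL-Combinatorics.Multiset_Permutations"
begin

text \<open>
  Indices follow the source: \<open>k\<close> ranges over \<open>1, \<dots>, n\<close>, so with the library's 0-based
  entries the 2-by-2 block of \<open>G_mat n \<alpha> \<beta> \<gamma> \<delta> k\<close> occupies rows and columns \<open>k - 1\<close> and \<open>k\<close>.
  The \<open>(n + 1)\<close>-by-\<open>(n + 1)\<close> format is meaningful only for \<open>1 \<le> k \<le> n\<close>.
\<close>

definition G_mat ::
  "nat \<Rightarrow> (nat \<Rightarrow> complex) \<Rightarrow> (nat \<Rightarrow> complex) \<Rightarrow> (nat \<Rightarrow> complex) \<Rightarrow> (nat \<Rightarrow> complex) \<Rightarrow> nat \<Rightarrow> complex mat"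
  where "G_mat n \<alpha> \<beta> \<gamma> \<delta> k =
    diag_block_mat [1\<^sub>m (k - 1), mat_of_rows_list 2 [[\<alpha> k, \<beta> k], [\<gamma> k, \<delta> k]], 1\<^sub>m (n - k)]"

text \<open>
  Matrices of type \<^typ>\<open>complex mat\<close> carry their dimensions and form no monoid type, so the
  ordered product is a right fold whose unit is the identity of size \<open>n + 1\<close>.
\<close>

definition M_mat ::
  "nat \<Rightarrow> (nat \<Rightarrow> complex) \<Rightarrow> (nat \<Rightarrow> complex) \<Rightarrow> (nat \<Rightarrow> complex) \<Rightarrow> (nat \<Rightarrow> complex) \<Rightarrow> nat list \<Rightarrow> complex mat"
  where "M_mat n \<alpha> \<beta> \<gamma> \<delta> \<pi> = foldr (*) (map (G_mat n \<alpha> \<beta> \<gamma> \<delta>) \<pi>) (1\<^sub>m (n + 1))"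

definition P_mat :: "nat \<Rightarrow> complex mat"
  where "P_mat n = four_block_mat (1\<^sub>m n) (0\<^sub>m n 1) (0\<^sub>m 0 n) (0\<^sub>m 0 1)"

end

theory Submission
  imports Defs "Jordan_Normal_Form.Column_Operations"
begin

text \<open>
  The factors \<open>G\<^sub>i\<close> and \<open>G\<^sub>j\<close> commute unless \<open>|i - j| = 1\<close>. Hence the last factor \<open>G\<^sub>n\<close>, which
  can fail to commute only with \<open>G\<^sub>n\<^sub>-\<^sub>1\<close>, can be moved to the right end of the product or to its left
  end, according to the side on which \<open>G\<^sub>n\<^sub>-\<^sub>1\<close> stands; what remains is a product of the same kind,
  of size one less, bordered by a \<open>1\<close>. This is \<open>M_mat_extract_last\<close>. The theorem then comes down
  to the fact that placing \<open>G\<^sub>n\<close> to the right or to the left of a bordered matrix \<open>X \<oplus> 1\<close> gives the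
  same determinant.

  To make this an induction, one considers the determinants of \<open>diag(a) M diag(b) + diag(d)\<close>, with
  a diagonal factor on both sides. This family is closed under transposition, which exchanges \<open>a\<close>
  with \<open>b\<close>, \<open>\<beta>\<close> with \<open>\<gamma>\<close> and the two ends of the product; so one cofactor expansion covers both
  ends. For \<open>M = (X \<oplus> 1) G\<^sub>n\<close> the last row of the matrix has at most two nonzero entries, and the two
  terms of the expansion are, up to scalar factors, again determinants of this form for \<open>X\<close>, with \<open>b\<^sub>n\<^sub>-\<^sub>1\<close> multiplied by \<open>\<alpha>\<^sub>n\<close> in one of
  them and \<open>d\<^sub>n\<^sub>-\<^sub>1\<close> replaced by \<open>0\<close> in the other (\<open>scaled_det_mult_last\<close>). For \<open>M = G\<^sub>n (X \<oplus> 1)\<close> the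
  same happens with \<open>a\<^sub>n\<^sub>-\<^sub>1\<close> multiplied by \<open>\<alpha>\<^sub>n\<close> (\<open>scaled_det_last_mult\<close>). In either case the product
  \<open>a\<^sub>n\<^sub>-\<^sub>1 b\<^sub>n\<^sub>-\<^sub>1\<close> is multiplied by \<open>\<alpha>\<^sub>n\<close>, and only such products survive to the end of the
  recursion. So the determinant is given by a recursion in the numbers \<open>a\<^sub>i b\<^sub>i\<close> and \<open>d\<^sub>i\<close> that makes
  no reference to the permutation (\<open>scaled_det_M_mat\<close>).

  The compression by \<open>P\<close> costs nothing: setting the last diagonal entry of \<open>A\<close> to \<open>0\<close> and that of
  \<open>D\<close> to \<open>1\<close> turns the last row of \<open>A M + D\<close> into a unit vector, so that the full determinant becomes
  the leading minor of order \<open>n\<close> (\<open>det_compress_eq_scaled_det\<close>).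
\<close>

section \<open>The factors and their products\<close>

lemma index_mult_mat_sum:
  assumes "A \<in> carrier_mat nr m" "B \<in> carrier_mat m nc" "i < nr" "j < nc"
  shows "(A * B) $$ (i, j) = (\<Sum>k = 0..<m. A $$ (i, k) * B $$ (k, j))"
  using assms by (simp add: scalar_prod_def del: sum.op_ivl_Suc)

lemma G_mat_carrier:
  assumes "1 \<le> k" "k \<le> n"
  shows "G_mat n \<alpha> \<beta> \<gamma> \<delta> k \<in> carrier_mat (n + 1) (n + 1)"
  using assms
  by (intro carrier_matI) (auto simp: G_mat_def dim_diag_block_mat mat_of_rows_list_def)

lemma G_mat_index:
  assumes "1 \<le> k" "k \<le> n" "i \<le> n" "j \<le> n"
  shows "G_mat n \<alpha> \<beta> \<gamma> \<delta> k $$ (i, j) =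
    (if i = k - 1 \<and> j = k - 1 then \<alpha> k
     else if i = k - 1 \<and> j = k then \<beta> k
     else if i = k \<and> j = k - 1 then \<gamma> k
     else if i = k \<and> j = k then \<delta> k
     else if i = j then 1 else 0)"
proof -
  obtain l where k: "k = Suc l" using assms(1) by (cases k) auto
  define B where "B = mat_of_rows_list 2 [[\<alpha> k, \<beta> k], [\<gamma> k, \<delta> k]]"
  define r where "r = n - k"
  have n: "n = Suc l + r" using assms(2) k by (simp add: r_def)
  have dim_B: "dim_row B = 2" "dim_col B = 2"
    by (simp_all add: B_def mat_of_rows_list_def)
  have B: "B $$ (0, 0) = \<alpha> k" "B $$ (0, Suc 0) = \<beta> k"
    "B $$ (Suc 0, 0) = \<gamma> k" "B $$ (Suc 0, Suc 0) = \<delta> k"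
    by (simp_all add: B_def mat_of_rows_list_def)
  have blocks: "G_mat n \<alpha> \<beta> \<gamma> \<delta> k =
      four_block_mat (1\<^sub>m l) (0\<^sub>m l (2 + r)) (0\<^sub>m (2 + r) l)
        (four_block_mat B (0\<^sub>m 2 r) (0\<^sub>m r 2) (1\<^sub>m r))"
  proof -
    have "G_mat n \<alpha> \<beta> \<gamma> \<delta> k = diag_block_mat [1\<^sub>m l, B, 1\<^sub>m r]"
      by (simp only: G_mat_def B_def r_def k diff_Suc_1)
    then show ?thesis
      by (simp only: diag_block_mat.simps(2)[of _ "[B, 1\<^sub>m r]"]
          diag_block_mat.simps(2)[of _ "[1\<^sub>m r]"] diag_block_mat_singleton Let_def
          index_mat_four_block dim_B index_one_mat)
  qed
  have tail: "i < l \<or> i = l \<or> i = Suc l \<or> (\<exists>s < r. i = l + s + 2)" if "i \<le> n" for i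
    using that n by presburger
  show ?thesis
    using tail[OF assms(3)] tail[OF assms(4)] unfolding blocks
    by (elim disjE exE conjE) (simp_all add: k dim_B B)
qed

lemma G_mat_transpose:
  assumes "1 \<le> k" "k \<le> n"
  shows "(G_mat n \<alpha> \<beta> \<gamma> \<delta> k)\<^sup>T = G_mat n \<alpha> \<gamma> \<beta> \<delta> k"
  using G_mat_carrier[OF assms, of \<alpha> \<beta> \<gamma> \<delta>] G_mat_carrier[OF assms, of \<alpha> \<gamma> \<beta> \<delta>] assms
  by (intro eq_matI) (auto simp: G_mat_index)

lemma G_mat_pad:
  assumes "1 \<le> k" "k \<le> n"
  shows "G_mat (n + r) \<alpha> \<beta> \<gamma> \<delta> k =
    four_block_mat (G_mat n \<alpha> \<beta> \<gamma> \<delta> k) (0\<^sub>m (n + 1) r) (0\<^sub>m r (n + 1)) (1\<^sub>m r)"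
  using G_mat_carrier[OF assms, of \<alpha> \<beta> \<gamma> \<delta>]
    G_mat_carrier[of k "n + r" \<alpha> \<beta> \<gamma> \<delta>] assms
  by (intro eq_matI) (auto simp: G_mat_index)

lemma G_mat_last:
  "G_mat (Suc m) \<alpha> \<beta> \<gamma> \<delta> (Suc m) =
    four_block_mat (1\<^sub>m m) (0\<^sub>m m 2) (0\<^sub>m 2 m)
      (mat_of_rows_list 2 [[\<alpha> (Suc m), \<beta> (Suc m)], [\<gamma> (Suc m), \<delta> (Suc m)]])"
  by (rule eq_matI) (auto simp: G_mat_def Let_def mat_of_rows_list_def)

text \<open>
  With respect to the splitting of the \<open>m + 2\<close> coordinates into the first \<open>m\<close> and the last two, each
  of the two factors is the identity on one of the summands.
\<close>

lemma G_mat_last_commute: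
  assumes "1 \<le> k" "k < m"
  shows "G_mat (Suc m) \<alpha> \<beta> \<gamma> \<delta> k * G_mat (Suc m) \<alpha> \<beta> \<gamma> \<delta> (Suc m) =
    G_mat (Suc m) \<alpha> \<beta> \<gamma> \<delta> (Suc m) * G_mat (Suc m) \<alpha> \<beta> \<gamma> \<delta> k"
proof -
  obtain l where m: "m = Suc l" using assms by (cases m) auto
  let ?G = "G_mat l \<alpha> \<beta> \<gamma> \<delta> k"
  let ?B = "mat_of_rows_list 2 [[\<alpha> (Suc m), \<beta> (Suc m)], [\<gamma> (Suc m), \<delta> (Suc m)]]"
  have G: "?G \<in> carrier_mat m m" using G_mat_carrier[of k l] assms m by simp
  have B: "?B \<in> carrier_mat 2 2" by (intro carrier_matI) (simp_all add: mat_of_rows_list_def)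
  have pad: "G_mat (Suc m) \<alpha> \<beta> \<gamma> \<delta> k = four_block_mat ?G (0\<^sub>m m 2) (0\<^sub>m 2 m) (1\<^sub>m 2)"
    using G_mat_pad[of k l 2 \<alpha> \<beta> \<gamma> \<delta>] assms m by simp
  show ?thesis
    unfolding pad G_mat_last
      mult_four_block_mat[OF G zero_carrier_mat zero_carrier_mat one_carrier_mat
        one_carrier_mat zero_carrier_mat zero_carrier_mat B]
      mult_four_block_mat[OF one_carrier_mat zero_carrier_mat zero_carrier_mat B
        G zero_carrier_mat zero_carrier_mat one_carrier_mat]
    using G B by simp
qed

lemma M_mat_carrier:
  assumes "set xs \<subseteq> {1..n}"
  shows "M_mat n \<alpha> \<beta> \<gamma> \<delta> xs \<in> carrier_mat (n + 1) (n + 1)"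
  using assms
proof (induction xs)
  case (Cons k xs)
  then show ?case
    using G_mat_carrier[of k n \<alpha> \<beta> \<gamma> \<delta>] by (auto simp: M_mat_def)
qed (simp add: M_mat_def)

lemma M_mat_Cons: "M_mat n \<alpha> \<beta> \<gamma> \<delta> (k # xs) = G_mat n \<alpha> \<beta> \<gamma> \<delta> k * M_mat n \<alpha> \<beta> \<gamma> \<delta> xs"
  by (simp add: M_mat_def)

lemma M_mat_append:
  assumes "set xs \<subseteq> {1..n}" "set ys \<subseteq> {1..n}"
  shows "M_mat n \<alpha> \<beta> \<gamma> \<delta> (xs @ ys) = M_mat n \<alpha> \<beta> \<gamma> \<delta> xs * M_mat n \<alpha> \<beta> \<gamma> \<delta> ys"
  using assms(1)
proof (induction xs)
  case Nil
  then show ?case using M_mat_carrier[OF assms(2), of \<alpha> \<beta> \<gamma> \<delta>] by (simp add: M_mat_def)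
next
  case (Cons k xs)
  then show ?case
    using M_mat_carrier[OF assms(2), of \<alpha> \<beta> \<gamma> \<delta>] M_mat_carrier[of xs n \<alpha> \<beta> \<gamma> \<delta>]
      G_mat_carrier[of k n \<alpha> \<beta> \<gamma> \<delta>]
    by (simp add: M_mat_Cons)
qed

lemma M_mat_pad:
  assumes "set xs \<subseteq> {1..n}"
  shows "M_mat (Suc n) \<alpha> \<beta> \<gamma> \<delta> xs =
    four_block_mat (M_mat n \<alpha> \<beta> \<gamma> \<delta> xs) (0\<^sub>m (n + 1) 1) (0\<^sub>m 1 (n + 1)) (1\<^sub>m 1)"
  using assms
proof (induction xs)
  case Nil
  show ?case by (rule eq_matI) (auto simp: M_mat_def)
next
  case (Cons k xs)
  have G: "G_mat n \<alpha> \<beta> \<gamma> \<delta> k \<in> carrier_mat (n + 1) (n + 1)"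
    using Cons.prems by (intro G_mat_carrier) auto
  have M: "M_mat n \<alpha> \<beta> \<gamma> \<delta> xs \<in> carrier_mat (n + 1) (n + 1)"
    using Cons.prems by (intro M_mat_carrier) auto
  have "M_mat (Suc n) \<alpha> \<beta> \<gamma> \<delta> (k # xs) =
      four_block_mat (G_mat n \<alpha> \<beta> \<gamma> \<delta> k) (0\<^sub>m (n + 1) 1) (0\<^sub>m 1 (n + 1)) (1\<^sub>m 1) *
      four_block_mat (M_mat n \<alpha> \<beta> \<gamma> \<delta> xs) (0\<^sub>m (n + 1) 1) (0\<^sub>m 1 (n + 1)) (1\<^sub>m 1)"
    using G_mat_pad[of k n 1 \<alpha> \<beta> \<gamma> \<delta>] Cons by (simp add: M_mat_Cons)
  also have "\<dots> = four_block_mat (M_mat n \<alpha> \<beta> \<gamma> \<delta> (k # xs)) (0\<^sub>m (n + 1) 1) (0\<^sub>m 1 (n + 1)) (1\<^sub>m 1)"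
    unfolding M_mat_Cons
    by (subst mult_four_block_mat[OF G _ _ _ M]) (use G M in auto)
  finally show ?case .
qed

lemma M_mat_last_commute:
  assumes "set xs \<subseteq> {1..<m}"
  shows "M_mat (Suc m) \<alpha> \<beta> \<gamma> \<delta> xs * G_mat (Suc m) \<alpha> \<beta> \<gamma> \<delta> (Suc m) =
    G_mat (Suc m) \<alpha> \<beta> \<gamma> \<delta> (Suc m) * M_mat (Suc m) \<alpha> \<beta> \<gamma> \<delta> xs"
  using assms
proof (induction xs)
  case Nil
  then show ?case
    using G_mat_carrier[of "Suc m" "Suc m" \<alpha> \<beta> \<gamma> \<delta>] by (simp add: M_mat_def)
next
  case (Cons k xs)
  let ?G = "G_mat (Suc m) \<alpha> \<beta> \<gamma> \<delta>"
  let ?M = "M_mat (Suc m) \<alpha> \<beta> \<gamma> \<delta> xs"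
  have k: "1 \<le> k" "k < m" using Cons.prems by auto
  have C: "?G k \<in> carrier_mat (m + 2) (m + 2)" "?G (Suc m) \<in> carrier_mat (m + 2) (m + 2)"
    "?M \<in> carrier_mat (m + 2) (m + 2)"
    using G_mat_carrier[of _ "Suc m" \<alpha> \<beta> \<gamma> \<delta>] k M_mat_carrier[of xs "Suc m" \<alpha> \<beta> \<gamma> \<delta>] Cons.prems
    by force+
  have "(?G k * ?M) * ?G (Suc m) = ?G k * (?M * ?G (Suc m))"
    using C by (intro assoc_mult_mat)
  also have "\<dots> = ?G k * (?G (Suc m) * ?M)" using Cons by simp
  also have "\<dots> = (?G k * ?G (Suc m)) * ?M" using C by (intro assoc_mult_mat[symmetric])
  also have "\<dots> = (?G (Suc m) * ?G k) * ?M" using k by (simp add: G_mat_last_commute)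
  also have "\<dots> = ?G (Suc m) * (?G k * ?M)" using C by (intro assoc_mult_mat)
  finally show ?case by (simp add: M_mat_Cons)
qed

text \<open>
  Both \<open>us\<close> and \<open>vs\<close> in a splitting \<open>xs = us @ Suc m # vs\<close> could obstruct the passage of the last
  factor, but \<open>m\<close>, the only index whose factor may fail to commute with it, occurs in at most one of
  them. The list \<open>ys\<close> is \<open>us @ vs\<close>.
\<close>

lemma M_mat_extract_last:
  assumes "xs \<in> permutations_of_set {1..Suc m}"
  obtains ys where "ys \<in> permutations_of_set {1..m}"
    and "M_mat (Suc m) \<alpha> \<beta> \<gamma> \<delta> xs =
        M_mat (Suc m) \<alpha> \<beta> \<gamma> \<delta> ys * G_mat (Suc m) \<alpha> \<beta> \<gamma> \<delta> (Suc m) \<or>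
      M_mat (Suc m) \<alpha> \<beta> \<gamma> \<delta> xs =
        G_mat (Suc m) \<alpha> \<beta> \<gamma> \<delta> (Suc m) * M_mat (Suc m) \<alpha> \<beta> \<gamma> \<delta> ys"
proof -
  let ?G = "G_mat (Suc m) \<alpha> \<beta> \<gamma> \<delta> (Suc m)"
  let ?M = "M_mat (Suc m) \<alpha> \<beta> \<gamma> \<delta>"
  have xs: "set xs = {1..Suc m}" "distinct xs"
    using assms by (auto simp: permutations_of_set_def)
  then obtain us vs where split: "xs = us @ Suc m # vs"
    using split_list[of "Suc m" xs] by auto
  have set_eq: "set us \<union> set vs = {1..m}"
  proof -
    have "set us \<union> set vs = set xs - {Suc m}" using xs(2) split by auto
    also have "\<dots> = {1..m}" unfolding xs(1) by auto
    finally show ?thesis .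
  qed
  have perm: "us @ vs \<in> permutations_of_set {1..m}"
    using xs(2) split set_eq by (auto simp: permutations_of_set_def)
  have le: "set us \<subseteq> {1..m}" "set vs \<subseteq> {1..m}"
    unfolding set_eq[symmetric] by simp_all
  have incl: "{1..m} \<subseteq> {1..Suc m}" by simp
  have sub: "set us \<subseteq> {1..Suc m}" "set vs \<subseteq> {1..Suc m}"
    by (rule subset_trans[OF le(1) incl], rule subset_trans[OF le(2) incl])
  have minus: "{1..m} - {m} = {1..<m}" by auto
  have C: "?M us \<in> carrier_mat (m + 2) (m + 2)" "?M vs \<in> carrier_mat (m + 2) (m + 2)"
    "?G \<in> carrier_mat (m + 2) (m + 2)"
    using M_mat_carrier[OF sub(1), of \<alpha> \<beta> \<gamma> \<delta>] M_mat_carrier[OF sub(2), of \<alpha> \<beta> \<gamma> \<delta>]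
      G_mat_carrier[of "Suc m" "Suc m" \<alpha> \<beta> \<gamma> \<delta>] by auto
  have M: "?M xs = ?M us * (?G * ?M vs)" "?M (us @ vs) = ?M us * ?M vs"
    using sub by (simp_all add: split M_mat_append M_mat_Cons)
  have "?M xs = ?M (us @ vs) * ?G \<or> ?M xs = ?G * ?M (us @ vs)"
  proof (cases "m \<in> set vs")
    case False
    have "set vs \<subseteq> {1..<m}"
      unfolding minus[symmetric] using le(2) False by blast
    then have "?M vs * ?G = ?G * ?M vs" by (rule M_mat_last_commute)
    then show ?thesis using C by (simp add: M)
  next
    case True
    then have "m \<notin> set us" using xs(2) split by auto
    have "set us \<subseteq> {1..<m}"
      unfolding minus[symmetric] using le(1) \<open>m \<notin> set us\<close> by blast
    then have "?M us * ?G = ?G * ?M us" by (rule M_mat_last_commute)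
    then have "?M xs = ?G * ?M us * ?M vs"
      using C by (simp only: M(1) assoc_mult_mat[OF C(1,3,2), symmetric])
    then show ?thesis by (simp only: M(2) assoc_mult_mat[OF C(3,1,2)] simp_thms)
  qed
  then show ?thesis using perm that by blast
qed

section \<open>Expansion along the last row\<close>

text \<open>
  This is \<open>det (diag(a) X diag(b) + diag(d))\<close>. The diagonal matrices are given by functions on all
  indices, so that the same \<open>a\<close>, \<open>b\<close>, \<open>d\<close> serve for matrices of different sizes.
\<close>

definition scaled_det ::
  "nat \<Rightarrow> (nat \<Rightarrow> complex) \<Rightarrow> (nat \<Rightarrow> complex) \<Rightarrow> (nat \<Rightarrow> complex) \<Rightarrow> complex mat \<Rightarrow> complex"
  where "scaled_det N a b d X =
    det (mat N N (\<lambda>(i, j). a i * X $$ (i, j) * b j + (if i = j then d i else 0)))"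

lemma scaled_det_transpose:
  assumes "X \<in> carrier_mat N N"
  shows "scaled_det N a b d X\<^sup>T = scaled_det N b a d X"
proof -
  let ?Y = "mat N N (\<lambda>(i, j). b i * X $$ (i, j) * a j + (if i = j then d i else 0))"
  have "mat N N (\<lambda>(i, j). a i * X\<^sup>T $$ (i, j) * b j + (if i = j then d i else 0)) = ?Y\<^sup>T"
    using assms by (intro eq_matI) auto
  then show ?thesis
    using det_transpose[of ?Y N] by (simp add: scaled_det_def)
qed

lemma det_mat_scale_last_col:
  "det (mat (Suc m) (Suc m) (\<lambda>(i, j). if j = m then x * f i j else f i j)) =
   x * det (mat (Suc m) (Suc m) (\<lambda>(i, j). f i j :: complex))"
proof -
  let ?A = "mat (Suc m) (Suc m) (\<lambda>(i, j). f i j)"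
  have "mat (Suc m) (Suc m) (\<lambda>(i, j). if j = m then x * f i j else f i j) = multcol m x ?A"
    by (rule eq_matI) auto
  also have "\<dots> = ?A * multrow_mat (Suc m) m x"
    by (rule multcol_mat) auto
  also have "det \<dots> = det ?A * x"
    by (subst det_mult[of _ "Suc m"]) (auto simp: det_multrow_mat)
  finally show ?thesis by simp
qed

lemma padded_mult_G_mat_index:
  assumes X: "X \<in> carrier_mat (Suc m) (Suc m)" and "i \<le> Suc m" "j \<le> Suc m"
  shows "(four_block_mat X (0\<^sub>m (m + 1) 1) (0\<^sub>m 1 (m + 1)) (1\<^sub>m 1) *
      G_mat (Suc m) \<alpha> \<beta> \<gamma> \<delta> (Suc m)) $$ (i, j) =
    (if i \<le> m then
       if j < m then X $$ (i, j)
       else if j = m then X $$ (i, m) * \<alpha> (Suc m) else X $$ (i, m) * \<beta> (Suc m)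
     else if j < m then 0 else if j = m then \<gamma> (Suc m) else \<delta> (Suc m))"
proof -
  let ?G = "G_mat (Suc m) \<alpha> \<beta> \<gamma> \<delta> (Suc m)"
  let ?Y = "four_block_mat X (0\<^sub>m (m + 1) 1) (0\<^sub>m 1 (m + 1)) (1\<^sub>m 1)"
  have G: "?G \<in> carrier_mat (Suc (Suc m)) (Suc (Suc m))"
    using G_mat_carrier[of "Suc m" "Suc m" \<alpha> \<beta> \<gamma> \<delta>] by simp
  have "(?Y * ?G) $$ (i, j) = (\<Sum>k = 0..<Suc (Suc m). ?Y $$ (i, k) * ?G $$ (k, j))"
    using X G assms(2,3) by (intro index_mult_mat_sum) auto
  also have "\<dots> = (\<Sum>k = 0..<m. ?Y $$ (i, k) * (if k = j then 1 else 0)) +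
      ?Y $$ (i, m) * ?G $$ (m, j) + ?Y $$ (i, Suc m) * ?G $$ (Suc m, j)"
    using assms(3) by (simp add: G_mat_index)
  also have "(\<Sum>k = 0..<m. ?Y $$ (i, k) * (if k = j then 1 else 0)) =
      (if j < m then ?Y $$ (i, j) else 0)"
    by (simp add: sum.delta if_distrib cong: if_cong)
  finally show ?thesis
    using X assms(2,3) by (auto simp: G_mat_index)
qed

text \<open>
  The recursion step when the last factor stands on the right. Deleting the last row and column
  leaves the last column of \<open>X\<close> with the factor \<open>\<alpha>\<close>. Deleting instead the column before the last
  leaves that column with the factor \<open>\<beta>\<close>, and without the diagonal term \<open>d\<^sub>m\<close>, which lay in the
  deleted column.
\<close>

lemma scaled_det_mult_last:
  assumes X: "X \<in> carrier_mat (Suc m) (Suc m)"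
  shows "scaled_det (Suc (Suc m)) a b d
      (four_block_mat X (0\<^sub>m (m + 1) 1) (0\<^sub>m 1 (m + 1)) (1\<^sub>m 1) * G_mat (Suc m) \<alpha> \<beta> \<gamma> \<delta> (Suc m)) =
    (a (Suc m) * b (Suc m) * \<delta> (Suc m) + d (Suc m)) *
      scaled_det (Suc m) a (b(m := b m * \<alpha> (Suc m))) d X -
    a (Suc m) * b (Suc m) * \<beta> (Suc m) * \<gamma> (Suc m) * scaled_det (Suc m) a b (d(m := 0)) X"
proof -
  define Y where "Y = four_block_mat X (0\<^sub>m (m + 1) 1) (0\<^sub>m 1 (m + 1)) (1\<^sub>m 1) *
    G_mat (Suc m) \<alpha> \<beta> \<gamma> \<delta> (Suc m)"
  let ?N = "mat (Suc (Suc m)) (Suc (Suc m))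
    (\<lambda>(i, j). a i * Y $$ (i, j) * b j + (if i = j then d i else 0))"
  note Y = padded_mult_G_mat_index[OF X, of _ _ \<alpha> \<beta> \<gamma> \<delta>, folded Y_def]
  let ?f = "\<lambda>i j. a i * X $$ (i, j) * (if j = m then 1 else b j) +
    (if i = j then (d(m := 0)) i else 0)"
  let ?c = "det (mat (Suc m) (Suc m) (\<lambda>(i, j). ?f i j))"
  have del1: "mat_delete ?N (Suc m) (Suc m) =
      mat (Suc m) (Suc m) (\<lambda>(i, j). a i * X $$ (i, j) * (b(m := b m * \<alpha> (Suc m))) j +
        (if i = j then d i else 0))"
    by (rule eq_matI) (auto simp: mat_delete_def Y)
  have del2: "mat_delete ?N (Suc m) m =
      mat (Suc m) (Suc m) (\<lambda>(i, j). if j = m then b (Suc m) * \<beta> (Suc m) * ?f i j else ?f i j)"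
    by (rule eq_matI) (auto simp: mat_delete_def Y)
  \<comment> \<open>The minor \<open>del2\<close> has the scalar \<open>b (Suc m)\<close> in its last column where \<open>b m\<close> is wanted. The
    scalar \<open>b m\<close> is supplied by the entry of the last row that multiplies the minor; the column
    is therefore taken with scalar \<open>1\<close> in \<open>?f\<close>, and both scalars are factored out.\<close>
  have scale: "scaled_det (Suc m) a b (d(m := 0)) X =b m * ?c"
    unfolding scaled_det_def det_mat_scale_last_col[symmetric]
    by (rule arg_cong[where f = det], rule eq_matI) auto
  have "det ?N = (\<Sum>j<Suc (Suc m). ?N $$ (Suc m, j) * cofactor ?N (Suc m) j)"
    by (rule laplace_expansion_row) auto
  also have "\<dots> = ?N $$ (Suc m, m) * cofactor ?N (Suc m) m +
      ?N $$ (Suc m, Suc m) * cofactor ?N (Suc m) (Suc m)"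
    by (simp add: Y)
  also have "?N $$ (Suc m, m) = a (Suc m) * \<gamma> (Suc m) * b m" by (simp add: Y)
  also have "?N $$ (Suc m, Suc m) = a (Suc m) * b (Suc m) * \<delta> (Suc m) + d (Suc m)"
    by (simp add: Y)
  also have "cofactor ?N (Suc m) (Suc m) = scaled_det (Suc m) a (b(m := b m * \<alpha> (Suc m))) d X"
    by (simp add: cofactor_def del1 scaled_det_def)
  also have "cofactor ?N (Suc m) m =
      - (b (Suc m) * \<beta> (Suc m) * ?c)"
    unfolding cofactor_def del2 det_mat_scale_last_col by simp
  finally have "det ?N =
      a (Suc m) * \<gamma> (Suc m) * b m * - (b (Suc m) * \<beta> (Suc m) * ?c) +
      (a (Suc m) * b (Suc m) * \<delta> (Suc m) + d (Suc m)) *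
        scaled_det (Suc m) a (b(m := b m * \<alpha> (Suc m))) d X" .
  then show ?thesis
    unfolding Y_def[symmetric] scaled_det_def[of "Suc (Suc m)"] scale
    by (rule trans) (simp add: algebra_simps del: fun_upd_apply)
qed

text \<open>
  The transpose of \<open>scaled_det_mult_last\<close>. Its right-hand side differs only in that \<open>\<alpha>\<close> has gone
  to \<open>a\<close> instead of \<open>b\<close>.
\<close>

lemma scaled_det_last_mult:
  assumes X: "X \<in> carrier_mat (Suc m) (Suc m)"
  shows "scaled_det (Suc (Suc m)) a b d
      (G_mat (Suc m) \<alpha> \<beta> \<gamma> \<delta> (Suc m) * four_block_mat X (0\<^sub>m (m + 1) 1) (0\<^sub>m 1 (m + 1)) (1\<^sub>m 1)) =
    (a (Suc m) * b (Suc m) * \<delta> (Suc m) + d (Suc m)) *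
      scaled_det (Suc m) (a(m := a m * \<alpha> (Suc m))) b d X -
    a (Suc m) * b (Suc m) * \<beta> (Suc m) * \<gamma> (Suc m) * scaled_det (Suc m) a b (d(m := 0)) X"
proof -
  let ?G = "G_mat (Suc m) \<alpha> \<beta> \<gamma> \<delta> (Suc m)"
  let ?Y = "four_block_mat X (0\<^sub>m (m + 1) 1) (0\<^sub>m 1 (m + 1)) (1\<^sub>m 1)"
  have G: "?G \<in> carrier_mat (Suc (Suc m)) (Suc (Suc m))"
    using G_mat_carrier[of "Suc m" "Suc m" \<alpha> \<beta> \<gamma> \<delta>] by simp
  have Y: "?Y \<in> carrier_mat (Suc (Suc m)) (Suc (Suc m))" using X by auto
  have "(?G * ?Y)\<^sup>T = ?Y\<^sup>T * ?G\<^sup>T" using G Y by (rule transpose_mult)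
  also have "?Y\<^sup>T = four_block_mat X\<^sup>T (0\<^sub>m (m + 1) 1) (0\<^sub>m 1 (m + 1)) (1\<^sub>m 1)"
    using X by (intro eq_matI) auto
  also have "?G\<^sup>T = G_mat (Suc m) \<alpha> \<gamma> \<beta> \<delta> (Suc m)" by (simp add: G_mat_transpose)
  finally have T: "(?G * ?Y)\<^sup>T = four_block_mat X\<^sup>T (0\<^sub>m (m + 1) 1) (0\<^sub>m 1 (m + 1)) (1\<^sub>m 1) *
    G_mat (Suc m) \<alpha> \<gamma> \<beta> \<delta> (Suc m)" .
  have "?G * ?Y \<in> carrier_mat (Suc (Suc m)) (Suc (Suc m))" using G Y by simp
  then have "scaled_det (Suc (Suc m)) a b d (?G * ?Y) =
      scaled_det (Suc (Suc m)) b a d (?G * ?Y)\<^sup>T"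
    by (simp add: scaled_det_transpose)
  also have "\<dots> = (b (Suc m) * a (Suc m) * \<delta> (Suc m) + d (Suc m)) *
      scaled_det (Suc m) b (a(m := a m * \<alpha> (Suc m))) d X\<^sup>T -
    b (Suc m) * a (Suc m) * \<gamma> (Suc m) * \<beta> (Suc m) * scaled_det (Suc m) b a (d(m := 0)) X\<^sup>T"
    unfolding T by (rule scaled_det_mult_last) (use X in simp)
  finally show ?thesis by (simp add: scaled_det_transpose[OF X] mult_ac)
qed

section \<open>Independence of the order of the factors\<close>

text \<open>
  The common form of the two recursion steps, with \<open>c\<^sub>i\<close> standing for \<open>a\<^sub>i b\<^sub>i\<close>: at this level it no
  longer matters which of the two diagonal factors has absorbed \<open>\<alpha>\<close>.
\<close>

fun chain_det ::
  "(nat \<Rightarrow> complex) \<Rightarrow> (nat \<Rightarrow> complex) \<Rightarrow> (nat \<Rightarrow> complex) \<Rightarrow> (nat \<Rightarrow> complex) \<Rightarrow>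
    nat \<Rightarrow> (nat \<Rightarrow> complex) \<Rightarrow> (nat \<Rightarrow> complex) \<Rightarrow> complex"
  where
    "chain_det \<alpha> \<beta> \<gamma> \<delta> 0 c d = c 0 + d 0"
  | "chain_det \<alpha> \<beta> \<gamma> \<delta> (Suc m) c d =
      (c (Suc m) * \<delta> (Suc m) + d (Suc m)) *
        chain_det \<alpha> \<beta> \<gamma> \<delta> m (c(m := c m * \<alpha> (Suc m))) d -
      c (Suc m) * \<beta> (Suc m) * \<gamma> (Suc m) * chain_det \<alpha> \<beta> \<gamma> \<delta> m c (d(m := 0))"

text \<open>
  The induction has to run over all \<open>a\<close>, \<open>b\<close>, \<open>d\<close>, because the two terms of the recursion use
  modified functions, and which of \<open>a\<close> and \<open>b\<close> is modified depends on the permutation.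
\<close>

lemma scaled_det_M_mat:
  assumes "xs \<in> permutations_of_set {1..n}"
  shows "scaled_det (Suc n) a b d (M_mat n \<alpha> \<beta> \<gamma> \<delta> xs) =
    chain_det \<alpha> \<beta> \<gamma> \<delta> n (\<lambda>i. a i * b i) d"
  using assms
proof (induction n arbitrary: a b d xs)
  case 0
  then show ?case by (simp add: M_mat_def scaled_det_def det_single)
next
  case (Suc m)
  obtain ys where ys: "ys \<in> permutations_of_set {1..m}"
    and or: "M_mat (Suc m) \<alpha> \<beta> \<gamma> \<delta> xs =
        M_mat (Suc m) \<alpha> \<beta> \<gamma> \<delta> ys * G_mat (Suc m) \<alpha> \<beta> \<gamma> \<delta> (Suc m) \<or>
      M_mat (Suc m) \<alpha> \<beta> \<gamma> \<delta> xs =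
        G_mat (Suc m) \<alpha> \<beta> \<gamma> \<delta> (Suc m) * M_mat (Suc m) \<alpha> \<beta> \<gamma> \<delta> ys"
    by (rule M_mat_extract_last[OF Suc.prems])
  have set_ys: "set ys \<subseteq> {1..m}" using ys by (auto simp: permutations_of_set_def)
  have X: "M_mat m \<alpha> \<beta> \<gamma> \<delta> ys \<in> carrier_mat (Suc m) (Suc m)"
    using M_mat_carrier[OF set_ys] by simp
  have upd: "(\<lambda>i. a i * (b(m := b m * \<alpha> (Suc m))) i) =
        (\<lambda>i. a i * b i)(m := a m * b m * \<alpha> (Suc m))"
      "(\<lambda>i. (a(m := a m * \<alpha> (Suc m))) i * b i) =
        (\<lambda>i. a i * b i)(m := a m * b m * \<alpha> (Suc m))"
    by auto
  from or show ?case
    unfolding M_mat_pad[OF set_ys]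
    by (elim disjE)
      (simp_all only: scaled_det_mult_last[OF X] scaled_det_last_mult[OF X] Suc.IH[OF ys]
        chain_det.simps upd)
qed

section \<open>The truncated determinant\<close>

lemma P_mat_compress_index:
  assumes Y: "Y \<in> carrier_mat (n + 1) (n + 1)" and "i < n" "j < n"
  shows "(P_mat n * Y * mat_adjoint (P_mat n)) $$ (i, j) = Y $$ (i, j)"
proof -
  have P: "P_mat n \<in> carrier_mat n (n + 1)" by (auto simp: P_mat_def)
  have Pi: "P_mat n $$ (i, k) = (if k = i then 1 else 0)" if "i < n" "k < n + 1" for i k
    using that by (auto simp: P_mat_def)
  have Q: "mat_adjoint (P_mat n) \<in> carrier_mat (n + 1) n"
    using P by (auto simp: mat_adjoint_def)
  have Qi: "mat_adjoint (P_mat n) $$ (k, j) = (if k = j then 1 else 0)" if "k < n + 1" "j < n" for k j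
    using that P by (auto simp: mat_adjoint_def mat_of_rows_index Pi)
  have PY: "(P_mat n * Y) $$ (i, k) = Y $$ (i, k)" if "k < n + 1" for k
  proof -
    have "(P_mat n * Y) $$ (i, k) = (\<Sum>l = 0..<n + 1. P_mat n $$ (i, l) * Y $$ (l, k))"
      by (rule index_mult_mat_sum[OF P Y assms(2) that])
    also have "\<dots> = (\<Sum>l = 0..<n + 1. if l = i then Y $$ (l, k) else 0)"
      using assms(2) by (intro sum.cong) (auto simp: Pi)
    finally show ?thesis using assms(2) by (simp add: sum.delta del: sum.op_ivl_Suc)
  qed
  have "(P_mat n * Y * mat_adjoint (P_mat n)) $$ (i, j) =
      (\<Sum>k = 0..<n + 1. (P_mat n * Y) $$ (i, k) * mat_adjoint (P_mat n) $$ (k, j))"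
    by (rule index_mult_mat_sum[OF mult_carrier_mat[OF P Y] Q assms(2,3)])
  also have "\<dots> = (\<Sum>k = 0..<n + 1. if k = j then Y $$ (i, k) else 0)"
    using assms(3) by (intro sum.cong) (auto simp: PY Qi)
  finally show ?thesis using assms(3) by (simp add: sum.delta del: sum.op_ivl_Suc)
qed

text \<open>
  With \<open>0\<close> and \<open>1\<close> as the last entries of the two diagonal matrices, the last row is a unit vector,
  and the cofactor expansion along it leaves exactly the leading minor.
\<close>

lemma det_compress_eq_scaled_det:
  assumes A: "A \<in> carrier_mat (n + 1) (n + 1)" "diagonal_mat A"
    and D: "D \<in> carrier_mat (n + 1) (n + 1)" "diagonal_mat D"
    and M: "M \<in> carrier_mat (n + 1) (n + 1)"
  shows "det (P_mat n * (A * M + D) * mat_adjoint (P_mat n)) =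
    scaled_det (Suc n) (\<lambda>i. if i = n then 0 else A $$ (i, i)) (\<lambda>_. 1)
      (\<lambda>i. if i = n then 1 else D $$ (i, i)) M"
proof -
  let ?Q = "P_mat n * (A * M + D) * mat_adjoint (P_mat n)"
  let ?N = "mat (Suc n) (Suc n) (\<lambda>(i, j). (if i = n then 0 else A $$ (i, i)) * M $$ (i, j) * 1 +
    (if i = j then if i = n then 1 else D $$ (i, i) else 0))"
  have AM: "(A * M) $$ (i, j) = A $$ (i, i) * M $$ (i, j)" if "i < n + 1" "j < n + 1" for i j
  proof -
    have "(A * M) $$ (i, j) = (\<Sum>k = 0..<n + 1. A $$ (i, k) * M $$ (k, j))"
      by (rule index_mult_mat_sum[OF A(1) M that])
    also have "\<dots> = (\<Sum>k = 0..<n + 1. if k = i then A $$ (i, k) * M $$ (k, j) else 0)"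
      using A that by (intro sum.cong) (auto simp: diagonal_mat_def)
    finally show ?thesis using that by (simp add: sum.delta del: sum.op_ivl_Suc)
  qed
  have minor: "mat_delete ?N n n = ?Q"
  proof (rule eq_matI)
    show "dim_row (mat_delete ?N n n) = dim_row ?Q" "dim_col (mat_delete ?N n n) = dim_col ?Q"
      by (auto simp: mat_delete_def P_mat_def mat_adjoint_def)
    fix i j assume "i < dim_row ?Q" "j < dim_col ?Q"
    then have ij: "i < n" "j < n" by (auto simp: P_mat_def mat_adjoint_def)
    have "?Q $$ (i, j) = (A * M + D) $$ (i, j)"
      using A D M ij by (intro P_mat_compress_index) auto
    also have "\<dots> = A $$ (i, i) * M $$ (i, j) + D $$ (i, j)"
      using A D M ij by (simp add: AM del: index_mult_mat(1))
    finally show "mat_delete ?N n n $$ (i, j) = ?Q $$ (i, j)"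
      using ij D by (auto simp: mat_delete_def diagonal_mat_def)
  qed
  have "det ?N = (\<Sum>j<Suc n. ?N $$ (n, j) * cofactor ?N n j)"
    by (rule laplace_expansion_row) auto
  also have "\<dots> = cofactor ?N n n" by simp
  also have "\<dots> = det ?Q" unfolding cofactor_def minor by simp
  finally show ?thesis by (simp add: scaled_det_def)
qed

theorem theorem11p3:
  fixes n :: nat
    and \<alpha> \<beta> \<gamma> \<delta> :: "nat \<Rightarrow> complex"
    and A D :: "complex mat"
    and \<pi> \<sigma> :: "nat list"
  assumes "A \<in> carrier_mat (n + 1) (n + 1)" and "diagonal_mat A"
    and "D \<in> carrier_mat (n + 1) (n + 1)" and "diagonal_mat D"
    and "\<pi> \<in> permutations_of_set {1..n}"
    and "\<sigma> \<in> permutations_of_set {1..n}"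
  shows "det (P_mat n * (A * M_mat n \<alpha> \<beta> \<gamma> \<delta> \<pi> + D) * mat_adjoint (P_mat n)) =
         det (P_mat n * (A * M_mat n \<alpha> \<beta> \<gamma> \<delta> \<sigma> + D) * mat_adjoint (P_mat n))"
proof -
  have "M_mat n \<alpha> \<beta> \<gamma> \<delta> xs \<in> carrier_mat (n + 1) (n + 1)"
    if "xs \<in> permutations_of_set {1..n}" for xs
    using that by (intro M_mat_carrier) (auto simp: permutations_of_set_def)
  then show ?thesis
    using assms by (simp only: det_compress_eq_scaled_det scaled_det_M_mat)
qed

end
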